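(* Let $H$ be a pre-Hilbert left $\mathbb O$-module with $\mathbb O$-inner product $\langle\cdot,\cdot\rangle$. Then for all $p\in\mathbb O$ and $u\in H$, $$\langle pu,u\rangle=p\,\langle u,u\rangle .$$
   Context: $\mathbb O$ denotes the octonions, with conjugation $\overline{\,\cdot\,}$ and real part $\mathrm{Re}$. A left $\mathbb O$-module is a real vector space $M$ with an $\mathbb R$-bilinear scalar multiplication $\mathbb O\times M\to M$, $1m=m$, such that $r(rm)=r^2m$ for all $r\in\mathbb O$, $m\in M$ (equivalently, $[p,q,m]:=(pq)m-p(qm)$ satisfies $[p,q,m]=-[q,p,m]$). A real linear map $f:M\to\mathbb O$ is $\mathbb O$-para-linear if $\mathrm{Re}\,(f(px)-pf(x))=0$ for all $p\in\mathbb O$, $x\in M$. A pre-Hilbert left $\mathbb O$-module is a left $\mathbb O$-module $H$ with an $\mathbb R$-bilinear map $\langle\cdot,\cdot\rangle:H\times H\to\mathbb O$ ($\mathbb O$-inner product) such that: (1) $\langle\cdot,u\rangle$ is $\mathbb O$-para-linear for all $u\in H$; (2) $\langle u,v\rangle=\overline{\langle v,u\rangle}$ for all $u,v\in H$; (3) $\langle u,u\rangle$ is a nonnegative real number, equal to $0$ iff $u=0$. *)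

theory Defs
  imports "HOL-Analysis.Analysis"
begin

text \<open>
  The octonions are built from \<^typ>\<open>complex\<close> by applying the Cayley--Dickson doubling
  \<open>(a, b) (c, d) = (a c - d* b, d a + b c*)\<close>, \<open>(a, b)* = (a*, - b)\<close> twice, where \<open>*\<close> after a
  letter is conjugation.
\<close>

datatype quat = Quat (quat_fst: complex) (quat_snd: complex)

instantiation quat :: "{real_vector, times, one}"
begin

definition "0 = Quat 0 0"
definition "1 = Quat 1 0"
definition "x + y = Quat (quat_fst x + quat_fst y) (quat_snd x + quat_snd y)"
definition "- x = Quat (- quat_fst x) (- quat_snd x)"
definition "x - y = Quat (quat_fst x - quat_fst y) (quat_snd x - quat_snd y)"
definition "r *\<^sub>R x = Quat (r *\<^sub>R quat_fst x) (r *\<^sub>R quat_snd x)"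
definition "x * y = Quat
  (quat_fst x * quat_fst y - cnj (quat_snd y) * quat_snd x)
  (quat_snd y * quat_fst x + quat_snd x * cnj (quat_fst y))"

instance
  by standard
    (auto simp: zero_quat_def plus_quat_def uminus_quat_def minus_quat_def scaleR_quat_def
      algebra_simps)

end

definition quat_cnj :: "quat \<Rightarrow> quat" where
  "quat_cnj x = Quat (cnj (quat_fst x)) (- quat_snd x)"

datatype octo = Octo (octo_fst: quat) (octo_snd: quat)

instantiation octo :: "{real_vector, times, one}"
begin

definition "0 = Octo 0 0"
definition "1 = Octo 1 0"
definition "x + y = Octo (octo_fst x + octo_fst y) (octo_snd x + octo_snd y)"
definition "- x = Octo (- octo_fst x) (- octo_snd x)"
definition "x - y = Octo (octo_fst x - octo_fst y) (octo_snd x - octo_snd y)"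
definition "r *\<^sub>R x = Octo (r *\<^sub>R octo_fst x) (r *\<^sub>R octo_snd x)"
definition "x * y = Octo
  (octo_fst x * octo_fst y - quat_cnj (octo_snd y) * octo_snd x)
  (octo_snd y * octo_fst x + octo_snd x * quat_cnj (octo_fst y))"

instance
  by standard
    (auto simp: zero_octo_def plus_octo_def uminus_octo_def minus_octo_def scaleR_octo_def
      scaleR_add_right scaleR_add_left)

end

definition octo_cnj :: "octo \<Rightarrow> octo" where
  "octo_cnj x = Octo (quat_cnj (octo_fst x)) (- octo_snd x)"

definition octo_Re :: "octo \<Rightarrow> real" where
  "octo_Re x = Re (quat_fst (octo_fst x))"

text \<open>The real number \<open>r\<close>, viewed as an octonion, is \<open>r *\<^sub>R 1\<close>: the library's \<^const>\<open>of_real\<close> is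
  only available on associative algebras.\<close>

locale left_octo_module =
  fixes smul :: "octo \<Rightarrow> 'a::real_vector \<Rightarrow> 'a"
  assumes smul_bilinear: "bilinear smul"
    and smul_one: "smul 1 m = m"
    and smul_smul_self: "smul r (smul r m) = smul (r * r) m"

definition octo_para_linear ::
    "(octo \<Rightarrow> 'a::real_vector \<Rightarrow> 'a) \<Rightarrow> ('a \<Rightarrow> octo) \<Rightarrow> bool" where
  "octo_para_linear smul f \<longleftrightarrow>
     linear f \<and> (\<forall>p x. octo_Re (f (smul p x) - p * f x) = 0)"

locale pre_hilbert_left_octo_module = left_octo_module smul
  for smul :: "octo \<Rightarrow> 'a::real_vector \<Rightarrow> 'a" +
  fixes ip :: "'a \<Rightarrow> 'a \<Rightarrow> octo"
  assumes ip_bilinear: "bilinear ip"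
    and ip_para_linear: "octo_para_linear smul (\<lambda>x. ip x u)"
    and ip_cnj: "ip u v = octo_cnj (ip v u)"
    and ip_nonneg: "\<exists>r\<ge>0. ip u u = r *\<^sub>R 1"
    and ip_eq_0_iff: "ip u u = 0 \<longleftrightarrow> u = 0"

end

theory Submission
  imports Defs
begin

text \<open>
  The real form \<open>B(x, y) = Re \<langle>x, y\<rangle>\<close> is symmetric, and para-linearity makes left multiplication
  by \<open>p*\<close> adjoint to left multiplication by \<open>p\<close>. Since \<open>p* (p x) = |p|\<^sup>2 x\<close> holds in every left
  module, \<open>B(p u, p u) = |p|\<^sup>2 B(u, u)\<close>; as \<open>B\<close> is symmetric, polarizing in \<open>p\<close> determines
  \<open>B(p u, q u) = Re (q* p) \<langle>u, u\<rangle>\<close>. These numbers are the real parts \<open>Re (q* \<langle>p u, u\<rangle>)\<close>, which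
  determine \<open>\<langle>p u, u\<rangle>\<close>.
\<close>

lemmas quat_defs = zero_quat_def one_quat_def plus_quat_def uminus_quat_def minus_quat_def
  scaleR_quat_def times_quat_def quat_cnj_def

lemmas octo_defs = zero_octo_def one_octo_def plus_octo_def uminus_octo_def minus_octo_def
  scaleR_octo_def times_octo_def octo_cnj_def octo_Re_def

lemma linear_octo_Re: "linear octo_Re"
  by (rule linearI) (simp_all add: octo_defs quat_defs)

lemma octo_Re_cnj [simp]: "octo_Re (octo_cnj x) = octo_Re x"
  by (simp add: octo_defs quat_defs)

lemma octo_cnj_cnj [simp]: "octo_cnj (octo_cnj x) = x"
  by (simp add: octo_defs quat_defs)

text \<open>Conjugation reverses products, and \<open>octo_Re\<close> ignores both conjugation and
  the order of two factors.\<close>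

lemma octo_Re_mult_cnj: "octo_Re (octo_cnj x * octo_cnj y) = octo_Re (x * y)"
  by (simp add: octo_defs quat_defs algebra_simps)

lemma octo_mult_right_diff_distrib: "(x :: octo) * (y - z) = x * y - x * z"
  by (simp add: octo_defs quat_defs algebra_simps)

lemma octo_mult_scaleR_right: "(x :: octo) * (r *\<^sub>R y) = r *\<^sub>R (x * y)"
  by (simp add: octo_defs quat_defs algebra_simps)

lemma octo_mult_one_right: "(x :: octo) * 1 = x"
  by (cases x) (simp add: octo_defs quat_defs)

lemma octo_cnj_eq: "octo_cnj p = (2 * octo_Re p) *\<^sub>R 1 - p"
  by (simp add: octo_defs quat_defs complex_eq_iff)

text \<open>The quadratic equation of an octonion, with trace \<open>2 * octo_Re p\<close> and norm
  \<open>octo_Re (octo_cnj p * p)\<close>.\<close>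

lemma octo_square:
  "p * p = (2 * octo_Re p) *\<^sub>R p - octo_Re (octo_cnj p * p) *\<^sub>R 1"
  by (simp add: octo_defs quat_defs complex_eq_iff algebra_simps)

lemma octo_Re_cnj_mult_add:
  "octo_Re (octo_cnj (p + q) * (p + q)) =
     octo_Re (octo_cnj p * p) + octo_Re (octo_cnj q * q) + 2 * octo_Re (octo_cnj q * p)"
  by (simp add: octo_defs quat_defs algebra_simps)

lemma octo_Re_cnj_mult_self:
  "octo_Re (octo_cnj x * x) =
     (cmod (quat_fst (octo_fst x)))\<^sup>2 + (cmod (quat_snd (octo_fst x)))\<^sup>2 +
     (cmod (quat_fst (octo_snd x)))\<^sup>2 + (cmod (quat_snd (octo_snd x)))\<^sup>2"
  unfolding cmod_power2 by (simp add: octo_defs quat_defs power2_eq_square)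

lemma octo_eqI:
  assumes "\<And>q. octo_Re (q * x) = octo_Re (q * y)"
  shows "x = y"
proof -
  \<comment> \<open>Testing with \<open>q = octo_cnj (x - y)\<close> produces the squared norm of
    \<open>x - y\<close>.\<close>
  have "octo_Re (octo_cnj (x - y) * (x - y)) = 0"
    by (simp add: octo_mult_right_diff_distrib linear_diff[OF linear_octo_Re] assms)
  then have "quat_fst (octo_fst (x - y)) = 0" "quat_snd (octo_fst (x - y)) = 0"
    "quat_fst (octo_snd (x - y)) = 0" "quat_snd (octo_snd (x - y)) = 0"
    by (simp_all add: octo_Re_cnj_mult_self add_nonneg_eq_0_iff)
  then show ?thesis
    by (intro octo.expand quat.expand conjI TrueI) (simp_all add: octo_defs quat_defs)
qed

text \<open>As \<open>octo_cnj p\<close> is a real combination of \<open>1\<close> and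
  \<open>p\<close>, only the square law \<open>smul_smul_self\<close> is needed in place of
  associativity.\<close>

lemma (in left_octo_module) smul_cnj_smul:
  "smul (octo_cnj p) (smul p m) = octo_Re (octo_cnj p * p) *\<^sub>R m"
proof -
  have "smul (octo_cnj p) (smul p m) = (2 * octo_Re p) *\<^sub>R smul p m - smul (p * p) m"
    unfolding octo_cnj_eq
    by (simp add: bilinear_lsub[OF smul_bilinear] bilinear_lmul[OF smul_bilinear] smul_one
        smul_smul_self)
  also have "\<dots> = octo_Re (octo_cnj p * p) *\<^sub>R m"
    unfolding octo_square
    by (simp add: bilinear_lsub[OF smul_bilinear] bilinear_lmul[OF smul_bilinear] smul_one)
  finally show ?thesis .
qed

context pre_hilbert_left_octo_module
begin

lemma Re_ip_commute: "octo_Re (ip x y) = octo_Re (ip y x)"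
  by (metis ip_cnj octo_Re_cnj)

lemma Re_ip_smul: "octo_Re (ip (smul p x) y) = octo_Re (p * ip x y)"
  using ip_para_linear[of y] by (simp add: octo_para_linear_def linear_diff[OF linear_octo_Re])

lemma Re_ip_smul_adjoint: "octo_Re (ip (smul p x) y) = octo_Re (ip x (smul (octo_cnj p) y))"
proof -
  have "octo_Re (ip x (smul (octo_cnj p) y)) = octo_Re (octo_cnj p * octo_cnj (ip x y))"
    by (simp only: Re_ip_commute[of x] Re_ip_smul ip_cnj[of y x])
  then show ?thesis
    by (simp add: octo_Re_mult_cnj Re_ip_smul)
qed

lemma Re_ip_smul_same:
  "octo_Re (ip (smul p u) (smul p u)) = octo_Re (octo_cnj p * p) * octo_Re (ip u u)"
  by (simp add: Re_ip_smul_adjoint smul_cnj_smul bilinear_rmul[OF ip_bilinear]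
      linear_scale[OF linear_octo_Re])

lemma Re_ip_smul_smul:
  "octo_Re (ip (smul p u) (smul q u)) = octo_Re (octo_cnj q * p) * octo_Re (ip u u)"
  \<comment> \<open>In the expansion at \<open>p + q\<close> the square terms cancel and the two
    mixed terms coincide by symmetry.\<close>
  using Re_ip_smul_same[of "p + q" u]
  by (simp add: octo_Re_cnj_mult_add Re_ip_smul_same Re_ip_commute[of "smul q u" "smul p u"]
      bilinear_ladd[OF smul_bilinear] bilinear_ladd[OF ip_bilinear] bilinear_radd[OF ip_bilinear]
      linear_add[OF linear_octo_Re] distrib_right)

lemma ip_smul_self: "ip (smul p u) u = p * ip u u"
proof (rule octo_eqI)
  fix q
  obtain r where r: "ip u u = r *\<^sub>R 1"
    using ip_nonneg by blast
  have "octo_Re (ip u u) = r"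
    by (simp add: r octo_defs quat_defs)
  \<comment> \<open>Para-linearity read backwards moves \<open>q\<close> into the first argument,
    and adjointness moves it to the second.\<close>
  moreover have "octo_Re (q * ip (smul p u) u) = octo_Re (ip (smul p u) (smul (octo_cnj q) u))"
    by (simp only: Re_ip_smul[symmetric] Re_ip_smul_adjoint[of q])
  \<comment> \<open>Both sides equal \<open>octo_Re (q * p) * r\<close>; the real factor
    \<open>r\<close> pulls out of the nested product.\<close>
  ultimately show "octo_Re (q * ip (smul p u) u) = octo_Re (q * (p * ip u u))"
    by (simp add: Re_ip_smul_smul r octo_mult_scaleR_right octo_mult_one_right
        linear_scale[OF linear_octo_Re])
qed

end

theorem mainTheorem3:
  fixes smul :: "octo \<Rightarrow> 'a::real_vector \<Rightarrow> 'a"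
    and ip :: "'a \<Rightarrow> 'a \<Rightarrow> octo"
    and p :: octo and u :: 'a
  assumes "pre_hilbert_left_octo_module smul ip"
  shows "ip (smul p u) u = p * ip u u"
  using assms by (rule pre_hilbert_left_octo_module.ip_smul_self)

end
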